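(* Suppose $(\boldsymbol{x}^*,\boldsymbol{m}^* )$ is a specialised Nash equilibrium induced by a $DP$-Nash subgraph $H$ of $G$ with partite sets $D$ and $P$, where (i) $m_i^*\cap N_H(i)\neq\emptyset$ for all $i\in P$, and (ii) $d_H(i)=1$ for some $i\in P$. Then $(\boldsymbol{x}^*,\boldsymbol{m}^* )$ is not action stable.
   Context: Setting: $G=(V,E)$ is a finite connected simple undirected graph with $V=\{1,\dots,n\}$, $N_G(i)$ is the neighbourhood of $i$, $d_G(i)=|N_G(i)|$, and $\kappa:V\to\mathbb{N}_0$ is a capacity function. Each player $i\in V$ chooses an action $x_i\in X=\{0,1,\dots,\bar x\}$ and a nomination $m_i\subseteq N_G(i)$ with $|m_i|=\min\{\kappa(i),d_G(i)\}$. Payoffs are $U_i(\boldsymbol{x},\boldsymbol{m})=f\big(x_i+\sum_{\{j\in N_G(i):\, i\in m_j\}}x_j\big)-c\,x_i$, with $f:\mathbb{N}_0\to\mathbb{R}$, $c>0$, and $q^*\in X$ a positive integer such that $q^*\in\operatorname{argmax}_{x\in X}(f(x)-cx)$ and $f(x)-cx$ is non-increasing for $x\ge q^*$. $DP$-Nash subgraph: a spanning bipartite subgraph $H$ of $G$ with partite sets $D$ and $P$ such that each $i\in D$ has degree $\min\{\kappa(i),d_G(i)\}$ in $H$ and each $i\in P$ has positive degree in $H$. $N_H(i)$ and $d_H(i)$ are the neighbourhood and degree of $i$ in $H$. A specialised profile induced by $H$ is a profile $(\boldsymbol{x}^*,\boldsymbol{m}^* )$ with $x_i^*=q^*$ and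 $m_i^*=N_H(i)$ for $i\in D$, and $x_i^*=0$ and $m_i^*$ an arbitrary admissible nomination for $i\in P$; any such profile is a pure strategy Nash equilibrium, called a specialised Nash equilibrium induced by $H$. Given $\boldsymbol{m}$, the best-action response of $i$ is $\mathcal{B}_{i,\boldsymbol{m}}(\boldsymbol{x})=\max\{q^*-\sum_{\{j\in N_G(i):\, i\in m_j\}}x_j,\;0\}$, and $\mathcal{B}_{\boldsymbol{m}}(\boldsymbol{x})=(\mathcal{B}_{1,\boldsymbol{m}}(\boldsymbol{x}),\dots,\mathcal{B}_{n,\boldsymbol{m}}(\boldsymbol{x}))$. The best-action evolution of $\boldsymbol{x}$ (with $\boldsymbol{m}$ fixed) is $\boldsymbol{x}^{(0)}=\boldsymbol{x}$, $\boldsymbol{x}^{(t)}=\mathcal{B}_{\boldsymbol{m}}(\boldsymbol{x}^{(t-1)})$ for $t\ge1$. It settles in $\boldsymbol{y}$ if there is $t_0$ with $\boldsymbol{x}^{(t)}=\boldsymbol{y}$ for all $t\ge t_0$. A profile $(\boldsymbol{x},\boldsymbol{m})$ is action stable if there exists $\delta\ge1$ such that for every individual $i$ and every action profile $\boldsymbol{x}'\in X^n$ with $x'_j=x_j$ for all $j\ne i$ and $|x'_i-x_i|\le\delta$, the best-action evolution of $\boldsymbol{x}'$ (with $\boldsymbol{m}$ fixed) settles in $\boldsymbol{x}$. *)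

theory Defs
  imports Complex_Main "HOL-Library.FuncSet" "Graph_Theory.Graph_Theory"
begin

text \<open>
  A finite simple undirected graph is a \<^locale>\<open>pair_graph\<close>: a finite loop-free digraph whose arcs
  are ordered pairs of vertices and whose arc relation is symmetric, so that an undirected edge
  between i and j is the pair of arcs (i, j) and (j, i).
\<close>

definition neighbours :: "'v pair_pre_digraph \<Rightarrow> 'v \<Rightarrow> 'v set" where
  "neighbours G i = {j. (i, j) \<in> parcs G}"

definition degree :: "'v pair_pre_digraph \<Rightarrow> 'v \<Rightarrow> nat" where
  "degree G i = card (neighbours G i)"

definition bipartition :: "'v pair_pre_digraph \<Rightarrow> 'v set \<Rightarrow> 'v set \<Rightarrow> bool" where
  "bipartition H D P \<longleftrightarrow>
     D \<union> P = pverts H \<and> D \<inter> P = {} \<and> parcs H \<subseteq> D \<times> P \<union> P \<times> D"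

definition DP_Nash_subgraph ::
  "'v pair_pre_digraph \<Rightarrow> ('v \<Rightarrow> nat) \<Rightarrow> 'v pair_pre_digraph \<Rightarrow> 'v set \<Rightarrow> 'v set \<Rightarrow> bool" where
  "DP_Nash_subgraph G \<kappa> H D P \<longleftrightarrow>
     pair_graph H \<and> spanning (with_proj H) (with_proj G) \<and> bipartition H D P \<and>
     (\<forall>i\<in>D. degree H i = min (\<kappa> i) (degree G i)) \<and>
     (\<forall>i\<in>P. 0 < degree H i)"

text \<open>
  Profiles are extensional functions on the vertex set, so that equality of functions is equality
  of profiles.
\<close>

definition action_profiles :: "'v pair_pre_digraph \<Rightarrow> nat \<Rightarrow> ('v \<Rightarrow> nat) set" where
  "action_profiles G xbar = pverts G \<rightarrow>\<^sub>E {0..xbar}"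

definition nominations :: "'v pair_pre_digraph \<Rightarrow> ('v \<Rightarrow> nat) \<Rightarrow> 'v \<Rightarrow> 'v set set" where
  "nominations G \<kappa> i = {s. s \<subseteq> neighbours G i \<and> card s = min (\<kappa> i) (degree G i)}"

definition nomination_profiles :: "'v pair_pre_digraph \<Rightarrow> ('v \<Rightarrow> nat) \<Rightarrow> ('v \<Rightarrow> 'v set) set" where
  "nomination_profiles G \<kappa> = (\<Pi>\<^sub>E i\<in>pverts G. nominations G \<kappa> i)"

definition received :: "'v pair_pre_digraph \<Rightarrow> ('v \<Rightarrow> 'v set) \<Rightarrow> ('v \<Rightarrow> nat) \<Rightarrow> 'v \<Rightarrow> nat" where
  "received G m x i = (\<Sum>j\<in>{j \<in> neighbours G i. i \<in> m j}. x j)"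

definition payoff ::
  "'v pair_pre_digraph \<Rightarrow> (nat \<Rightarrow> real) \<Rightarrow> real \<Rightarrow> 'v \<Rightarrow> ('v \<Rightarrow> nat) \<Rightarrow> ('v \<Rightarrow> 'v set) \<Rightarrow> real" where
  "payoff G f c i x m = f (x i + received G m x i) - c * real (x i)"

definition pure_Nash ::
  "'v pair_pre_digraph \<Rightarrow> ('v \<Rightarrow> nat) \<Rightarrow> nat \<Rightarrow> (nat \<Rightarrow> real) \<Rightarrow> real \<Rightarrow>
   ('v \<Rightarrow> nat) \<Rightarrow> ('v \<Rightarrow> 'v set) \<Rightarrow> bool" where
  "pure_Nash G \<kappa> xbar f c x m \<longleftrightarrow>
     x \<in> action_profiles G xbar \<and> m \<in> nomination_profiles G \<kappa> \<and>
     (\<forall>i\<in>pverts G. \<forall>a\<in>{0..xbar}. \<forall>s\<in>nominations G \<kappa> i.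
        payoff G f c i (x(i := a)) (m(i := s)) \<le> payoff G f c i x m)"

definition specialised_profile ::
  "'v pair_pre_digraph \<Rightarrow> ('v \<Rightarrow> nat) \<Rightarrow> nat \<Rightarrow> nat \<Rightarrow>
   'v pair_pre_digraph \<Rightarrow> 'v set \<Rightarrow> 'v set \<Rightarrow> ('v \<Rightarrow> nat) \<Rightarrow> ('v \<Rightarrow> 'v set) \<Rightarrow> bool" where
  "specialised_profile G \<kappa> xbar q H D P x m \<longleftrightarrow>
     x \<in> action_profiles G xbar \<and> m \<in> nomination_profiles G \<kappa> \<and>
     (\<forall>i\<in>D. x i = q \<and> m i = neighbours H i) \<and>
     (\<forall>i\<in>P. x i = 0)"

text \<open>
  The equilibrium conjunct is redundant in the setting below, see
  \<open>specialised_Nash_iff_specialised_profile\<close>.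
\<close>

definition specialised_Nash ::
  "'v pair_pre_digraph \<Rightarrow> ('v \<Rightarrow> nat) \<Rightarrow> nat \<Rightarrow> (nat \<Rightarrow> real) \<Rightarrow> real \<Rightarrow> nat \<Rightarrow>
   'v pair_pre_digraph \<Rightarrow> 'v set \<Rightarrow> 'v set \<Rightarrow> ('v \<Rightarrow> nat) \<Rightarrow> ('v \<Rightarrow> 'v set) \<Rightarrow> bool" where
  "specialised_Nash G \<kappa> xbar f c q H D P x m \<longleftrightarrow>
     specialised_profile G \<kappa> xbar q H D P x m \<and> pure_Nash G \<kappa> xbar f c x m"

text \<open>The difference below is truncated at 0, i.e. it is the maximum of the difference and 0.\<close>

definition best_action ::
  "'v pair_pre_digraph \<Rightarrow> nat \<Rightarrow> ('v \<Rightarrow> 'v set) \<Rightarrow> ('v \<Rightarrow> nat) \<Rightarrow> ('v \<Rightarrow> nat)" where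
  "best_action G q m x = (\<lambda>i\<in>pverts G. q - received G m x i)"

definition evolution ::
  "'v pair_pre_digraph \<Rightarrow> nat \<Rightarrow> ('v \<Rightarrow> 'v set) \<Rightarrow> ('v \<Rightarrow> nat) \<Rightarrow> nat \<Rightarrow> ('v \<Rightarrow> nat)" where
  "evolution G q m x t = (best_action G q m ^^ t) x"

definition settles_in ::
  "'v pair_pre_digraph \<Rightarrow> nat \<Rightarrow> ('v \<Rightarrow> 'v set) \<Rightarrow> ('v \<Rightarrow> nat) \<Rightarrow> ('v \<Rightarrow> nat) \<Rightarrow> bool" where
  "settles_in G q m x y \<longleftrightarrow> (\<exists>t0. \<forall>t\<ge>t0. evolution G q m x t = y)"

definition action_stable ::
  "'v pair_pre_digraph \<Rightarrow> nat \<Rightarrow> nat \<Rightarrow> ('v \<Rightarrow> nat) \<Rightarrow> ('v \<Rightarrow> 'v set) \<Rightarrow> bool" where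
  "action_stable G xbar q x m \<longleftrightarrow>
     (\<exists>\<delta>::real. \<delta> \<ge> 1 \<and>
       (\<forall>i\<in>pverts G. \<forall>x'\<in>action_profiles G xbar.
          (\<forall>j\<in>pverts G - {i}. x' j = x j) \<and> \<bar>real (x' i) - real (x i)\<bar> \<le> \<delta> \<longrightarrow>
          settles_in G q m x' x))"

text \<open>
  \<open>connected\<close> is qualified because the topological notion has the same name. It requires a nonempty
  vertex set, so \<open>n \<ge> 1\<close>.
\<close>

locale public_goods_game = pair_graph G for G :: "nat pair_pre_digraph" +
  fixes n xbar :: nat
    and f :: "nat \<Rightarrow> real" and c :: real and q :: nat
  assumes verts_eq: "pverts G = {1..n}"
    and connected_G: "Digraph_Component.connected (with_proj G)"
    and c_pos: "0 < c"
    and q_pos: "0 < q"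
    and q_argmax: "is_arg_max (\<lambda>x. f x - c * real x) (\<lambda>x. x \<in> {0..xbar}) q"
    and f_antimono: "antimono_on {q..} (\<lambda>x. f x - c * real x)"
begin

lemma specialised_profile_imp_pure_Nash:
  assumes H: "DP_Nash_subgraph G \<kappa> H D P"
    and sp: "specialised_profile G \<kappa> xbar q H D P x m"
  shows "pure_Nash G \<kappa> xbar f c x m"
proof -
  interpret H: pair_graph H using H by (simp add: DP_Nash_subgraph_def)
  have bip: "D \<union> P = pverts G" "D \<inter> P = {}" "parcs H \<subseteq> D \<times> P \<union> P \<times> D"
    and sub: "parcs H \<subseteq> parcs G"
    using H by (auto simp: DP_Nash_subgraph_def bipartition_def spanning_def subgraph_def)
  have D: "x i = q" "m i = neighbours H i" if "i \<in> D" for i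
    using sp that by (auto simp: specialised_profile_def)
  have P: "x i = 0" if "i \<in> P" for i
    using sp that by (auto simp: specialised_profile_def)
  have fin: "finite (neighbours G i)" for i
    by (rule finite_subset[OF _ finite_verts]) (auto simp: neighbours_def dest: in_arcsD2)
  have dev: "payoff G f c i (x(i := a)) (m(i := s))
      = f (a + received G m x i) - c * real a" for i a s
  proof -
    have "i \<notin> neighbours G i" using no_loops' by (auto simp: neighbours_def)
    hence "received G (m(i := s)) (x(i := a)) i = received G m x i"
      unfolding received_def by (intro sum.cong) auto
    thus ?thesis by (simp add: payoff_def)
  qed
  have "f (a + received G m x i) - c * real a \<le> payoff G f c i x m"
    if i: "i \<in> pverts G" and a: "a \<in> {0..xbar}" for i a
  proof (cases "i \<in> D")
    case True
    have "x j = 0" if "j \<in> neighbours G i" "i \<in> m j" for j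
    proof -
      have "j \<in> pverts G" using that(1) by (auto simp: neighbours_def dest: in_arcsD2)
      moreover have "j \<notin> D"
        using that(2) D(2)[of j] bip True by (auto simp: neighbours_def)
      ultimately show ?thesis using bip P by blast
    qed
    hence "received G m x i = 0" by (simp add: received_def)
    thus ?thesis using q_argmax a D(1)[OF True]
      by (force simp: payoff_def is_arg_max_def not_less)
  next
    case False
    hence iP: "i \<in> P" using i bip by blast
    hence "neighbours H i \<noteq> {}" using H by (force simp: DP_Nash_subgraph_def degree_def)
    then obtain j where j: "(i, j) \<in> parcs H" by (auto simp: neighbours_def)
    hence jD: "j \<in> D" using bip iP by blast
    have ij: "i \<in> m j" using D(2)[OF jD] H.arcs_symmetric[OF j] by (simp add: neighbours_def)
    have "x j \<le> received G m x i"
      unfolding received_def using j sub ij fin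
      by (intro member_le_sum) (auto simp: neighbours_def)
    hence "q \<le> received G m x i" using D(1)[OF jD] by simp
    hence "f (a + received G m x i) - c * real (a + received G m x i)
        \<le> f (received G m x i) - c * real (received G m x i)"
      by (intro monotone_onD[OF f_antimono, of "received G m x i" "a + received G m x i"]) auto
    thus ?thesis using P[OF iP] by (simp add: payoff_def algebra_simps)
  qed
  thus ?thesis using sp by (auto simp: pure_Nash_def specialised_profile_def dev)
qed

lemma specialised_Nash_iff_specialised_profile:
  assumes "DP_Nash_subgraph G \<kappa> H D P"
  shows "specialised_Nash G \<kappa> xbar f c q H D P x m \<longleftrightarrow> specialised_profile G \<kappa> xbar q H D P x m"
  using specialised_profile_imp_pure_Nash[OF assms] by (auto simp: specialised_Nash_def)

end

end

theory Submission
  imports Defs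
begin

text \<open>
  Let i be a player of P with a single H-neighbour k, and lower the action of k to q - 1. Then D
  and P get out of phase with each other. Whenever P plays 0 and k plays less than q, the next
  profile has all of D at q, while i, sponsored by k alone, plays at least 1. In the profile after
  that, P is back at 0, but k receives the contribution of i, whom condition (i) forces to nominate
  k, and again plays less than q. So k plays less than q at every even time.
\<close>

lemma neighbours_subset_pverts:
  assumes "pair_graph G"
  shows "neighbours G i \<subseteq> pverts G"
proof -
  interpret pair_graph G by fact
  show ?thesis by (auto simp: neighbours_def dest: in_arcsD2)
qed

lemma finite_neighbours:
  assumes "pair_graph G"
  shows "finite (neighbours G i)"
proof -
  interpret pair_graph G by fact
  show ?thesis by (rule finite_subset[OF neighbours_subset_pverts[OF assms] finite_verts])
qed

lemma neighbours_sym: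
  assumes "pair_graph G"
  shows "i \<in> neighbours G j \<longleftrightarrow> j \<in> neighbours G i"
proof -
  interpret pair_graph G by fact
  show ?thesis by (auto simp: neighbours_def intro: arcs_symmetric)
qed

lemma action_le_received:
  assumes "pair_graph G" "j \<in> neighbours G i" "i \<in> m j"
  shows "x j \<le> received G m x i"
  unfolding received_def
  using assms finite_neighbours[OF assms(1), of i] by (intro member_le_sum) auto

lemma evolution_add_2:
  "evolution G q m x (t + 2) = best_action G q m (best_action G q m (evolution G q m x t))"
  by (simp add: evolution_def)

context
  fixes G H :: "'v pair_pre_digraph" and \<kappa> :: "'v \<Rightarrow> nat" and D P :: "'v set"
    and q :: nat and m :: "'v \<Rightarrow> 'v set"
  assumes graph: "pair_graph G"
    and DP: "DP_Nash_subgraph G \<kappa> H D P"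
    and m_D: "\<And>j. j \<in> D \<Longrightarrow> m j = neighbours H j"
begin

lemma DP_graph: "pair_graph H"
  using DP by (simp add: DP_Nash_subgraph_def)

lemma DP_verts: "D \<union> P = pverts G"
  using DP by (auto simp: DP_Nash_subgraph_def bipartition_def spanning_def)

lemma DP_neighbours_subset: "neighbours H i \<subseteq> neighbours G i"
  using DP by (auto simp: DP_Nash_subgraph_def spanning_def subgraph_def neighbours_def)

lemma DP_neighbours_D: "j \<in> D \<Longrightarrow> neighbours H j \<subseteq> P"
  and DP_neighbours_P: "i \<in> P \<Longrightarrow> neighbours H i \<subseteq> D"
  using DP by (auto simp: DP_Nash_subgraph_def bipartition_def neighbours_def)

lemma nominated_by_D_iff: "j \<in> D \<Longrightarrow> i \<in> m j \<longleftrightarrow> j \<in> neighbours H i"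
  by (simp add: m_D neighbours_sym[OF DP_graph])

lemma received_from_D_neighbour:
  assumes "j \<in> D" "j \<in> neighbours H i"
  shows "y j \<le> received G m y i"
  using assms DP_neighbours_subset[of i] nominated_by_D_iff
  by (intro action_le_received[OF graph]) auto

text \<open>Members of \<open>D\<close> nominate only inside \<open>P\<close>, so every sponsor of a
  player in \<open>D\<close> lies in \<open>P\<close> and contributes nothing.\<close>

lemma best_action_D:
  assumes "j \<in> D" "\<And>i. i \<in> P \<Longrightarrow> y i = 0"
  shows "best_action G q m y j = q"
proof -
  have "received G m y j = 0"
    unfolding received_def
  proof (intro sum.neutral ballI)
    fix l assume l: "l \<in> {l \<in> neighbours G j. j \<in> m l}"
    show "y l = 0"
    proof (cases "l \<in> D")
      case True
      \<comment> \<open>This case is contradictory: \<open>l\<close> nominates \<open>j\<close>,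
        which puts \<open>j\<close> in \<open>P\<close>, while \<open>j\<close> is in
        \<open>D\<close>.\<close>
      hence "j \<in> P" using l m_D DP_neighbours_D by auto
      thus ?thesis using assms(2)[of j] assms(1) DP
        by (auto simp: DP_Nash_subgraph_def bipartition_def)
    next
      case False
      thus ?thesis using l assms(2) neighbours_subset_pverts[OF graph] DP_verts by blast
    qed
  qed
  thus ?thesis using assms(1) DP_verts by (auto simp: best_action_def)
qed

text \<open>Positive degree in \<open>H\<close> gives a neighbour in \<open>D\<close>. It nominates
  \<open>i\<close>, and its contribution alone already reaches \<open>q\<close>.\<close>

lemma best_action_P:
  assumes "i \<in> P" "\<And>j. j \<in> D \<Longrightarrow> y j = q"
  shows "best_action G q m y i = 0"
proof -
  have "neighbours H i \<noteq> {}"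
    using DP assms(1) by (force simp: DP_Nash_subgraph_def degree_def)
  then obtain j where j: "j \<in> neighbours H i" by blast
  hence "j \<in> D" using DP_neighbours_P assms(1) by blast
  hence "q \<le> received G m y i" using received_from_D_neighbour[OF _ j, of y] assms(2) by simp
  thus ?thesis by (simp add: best_action_def restrict_def assms(1) DP_verts[symmetric])
qed

text \<open>A sponsor in \<open>D\<close> must be an \<open>H\<close>-neighbour, hence
  \<open>k\<close>. The other sponsors lie in \<open>P\<close> and play 0, so \<open>i\<close>
  receives at most \<open>y k\<close> and has to make up the shortfall.\<close>

lemma best_action_leaf:
  assumes "i \<in> P" "neighbours H i = {k}" "\<And>j. j \<in> P \<Longrightarrow> y j = 0" "y k < q"
  shows "0 < best_action G q m y i"
proof -
  have "y l = 0" if "l \<in> neighbours G i" "i \<in> m l" "l \<noteq> k" for l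
    using that assms(2,3) nominated_by_D_iff[of l i] neighbours_subset_pverts[OF graph] DP_verts
    by blast
  hence "received G m y i \<le> y k"
    unfolding received_def using finite_neighbours[OF graph, of i]
    \<comment> \<open>Intersecting with \<open>{k}\<close> makes the inclusion trivial; the
      remaining sum is empty or \<open>y k\<close>, and either suffices for the upper bound.\<close>
    by (subst sum.mono_neutral_right[of _ "{l \<in> neighbours G i. i \<in> m l} \<inter> {k}"])
      (auto simp: Int_insert_right)
  thus ?thesis using assms(1,4) DP_verts by (auto simp: best_action_def)
qed

text \<open>One step lifts all of \<open>D\<close> to \<open>q\<close>, which sends \<open>P\<close>
  back to 0 in the next. The nomination of \<open>k\<close> by \<open>i\<close> turns the positive
  action of \<open>i\<close> into a loss for \<open>k\<close>.\<close>

lemma two_step_below_q: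
  assumes i: "i \<in> P" "neighbours H i = {k}" "k \<in> m i"
    and y: "\<And>j. j \<in> P \<Longrightarrow> y j = 0" "y k < q"
  defines "z \<equiv> best_action G q m (best_action G q m y)"
  shows "j \<in> P \<Longrightarrow> z j = 0" "z k < q"
proof -
  show "z j = 0" if "j \<in> P"
    unfolding z_def using that y(1) by (intro best_action_P best_action_D) auto
  have k: "k \<in> D" using DP_neighbours_P i by blast
  have "0 < best_action G q m y i" using i y by (intro best_action_leaf) auto
  also have "\<dots> \<le> received G m (best_action G q m y) k"
    using i DP_neighbours_subset[of i] neighbours_sym[OF graph]
    by (intro action_le_received[OF graph]) auto
  \<comment> \<open>Truncated subtraction of a positive amount is strict only if \<open>q\<close> is
    positive, which \<open>y k < q\<close> guarantees.\<close>
  finally show "z k < q" using k y(2) DP_verts by (auto simp: z_def best_action_def)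
qed

text \<open>The zeros on \<open>P\<close> belong to the invariant because the next double step
  starts from them.\<close>

lemma evolution_even_below_q:
  assumes "i \<in> P" "neighbours H i = {k}" "k \<in> m i" "\<And>j. j \<in> P \<Longrightarrow> y j = 0" "y k < q"
  shows "(\<forall>j\<in>P. evolution G q m y (2 * t) j = 0) \<and> evolution G q m y (2 * t) k < q"
proof (induction t)
  case 0
  thus ?case using assms by (simp add: evolution_def)
next
  case (Suc t)
  have "evolution G q m y (2 * Suc t) =
      best_action G q m (best_action G q m (evolution G q m y (2 * t)))"
    using evolution_add_2[of G q m y "2 * t"] by simp
  thus ?case using two_step_below_q[OF assms(1-3)] Suc.IH by simp
qed

end

theorem proposition3:
  fixes G H :: "nat pair_pre_digraph"
    and n xbar q :: nat
    and \<kappa> :: "nat \<Rightarrow> nat"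
    and f :: "nat \<Rightarrow> real"
    and c :: real
    and D P :: "nat set"
    and x :: "nat \<Rightarrow> nat"
    and m :: "nat \<Rightarrow> nat set"
  assumes "public_goods_game G n xbar f c q"
    and "DP_Nash_subgraph G \<kappa> H D P"
    and "specialised_Nash G \<kappa> xbar f c q H D P x m"
    and "\<forall>i\<in>P. m i \<inter> neighbours H i \<noteq> {}"
    and "\<exists>i\<in>P. degree H i = 1"
  shows "\<not> action_stable G xbar q x m"
proof
  interpret public_goods_game G n xbar f c q by fact
  have graph: "pair_graph G" by unfold_locales
  have x: "x \<in> action_profiles G xbar" "\<And>j. j \<in> P \<Longrightarrow> x j = 0" "\<And>j. j \<in> D \<Longrightarrow> x j = q"
    and m: "\<And>j. j \<in> D \<Longrightarrow> m j = neighbours H j"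
    using assms(3) by (auto simp: specialised_Nash_def specialised_profile_def)
  note DP = graph assms(2) m
  obtain i where i: "i \<in> P" "degree H i = 1" using assms(5) by blast
  then obtain k where k: "neighbours H i = {k}"
    by (auto simp: degree_def card_1_singleton_iff)
  have kmi: "k \<in> m i" using bspec[OF assms(4) i(1)] k by simp
  have kD: "k \<in> D" using DP_neighbours_P[OF DP i(1)] k by blast
  have kG: "k \<in> pverts G" using kD DP_verts[OF DP] by blast
  have kP: "k \<notin> P" using kD assms(2) by (auto simp: DP_Nash_subgraph_def bipartition_def)
  \<comment> \<open>As \<open>q\<close> is positive, this changes the action of \<open>k\<close> by
    exactly 1, which every \<delta> \<ge> 1 allows.\<close>
  define x' where "x' = x(k := q - 1)"
  have x': "x' \<in> action_profiles G xbar"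
    \<comment> \<open>The bound \<open>q - 1\<close> \<le> \<open>xbar\<close> comes from
      \<open>x k = q\<close> and the admissibility of \<open>x\<close>.\<close>
    using x(1) x(3)[OF kD] kG unfolding x'_def action_profiles_def PiE_iff extensional_def
    by fastforce
  assume "action_stable G xbar q x m"
  then obtain \<delta> :: real where "\<delta> \<ge> 1"
    and "\<And>x'. x' \<in> action_profiles G xbar \<Longrightarrow> \<forall>j\<in>pverts G - {k}. x' j = x j
      \<Longrightarrow> \<bar>real (x' k) - real (x k)\<bar> \<le> \<delta> \<Longrightarrow> settles_in G q m x' x"
    using kG unfolding action_stable_def by blast
  hence "settles_in G q m x' x"
    using x' x(3)[OF kD] q_pos by (auto simp: x'_def)
  \<comment> \<open>Settling covers all late times, so an even one can be picked: twice the settling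
    time is late enough.\<close>
  then obtain t where "evolution G q m x' (2 * t) = x"
    unfolding settles_in_def by (metis le_add1 mult_2)
  moreover have "evolution G q m x' (2 * t) k < q"
  proof -
    have "x' j = 0" if "j \<in> P" for j using that x(2) kP by (auto simp: x'_def)
    moreover have "x' k < q" using q_pos by (simp add: x'_def)
    ultimately show ?thesis using evolution_even_below_q[OF DP i(1) k kmi] by blast
  qed
  ultimately show False using x(3)[OF kD] by simp
qed

end
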